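(* With the notation of the context, put $\mathbf w_i=\mathbf u_i+\mathbf v_i$ and $\bar E=E+F$. The pair of equations $$\bar E\rho=\sum_{i=1}^n\Big(\tfrac12\rho_m|\mathbf w_i|^2+P_i-\eta\,\nabla_i\cdot\mathbf v_i\Big)+U\rho,\qquad F\rho=\sum_{i=1}^np_i$$ is equivalent to the pair of equations $$E\rho=\sum_{i=1}^n\Big(\tfrac12\rho_m|\mathbf u_i|^2+\tfrac12\rho_m|\mathbf v_i|^2+P_i\Big)+U\rho,\qquad F\rho=\sum_{i=1}^np_i,$$ and, therefore, also to the Schr\"odinger equation $i\hbar\Psi^*\partial\Psi=\Psi^*\hat H\Psi$.
   Context: Constants $\hbar,m>0$ and an integer $n\ge1$. Points of $\mathbb R\times\mathbb R^{3n}$ are $(t,\mathbf r_1,\dots,\mathbf r_n)$; spin variables are fixed parameters and suppressed. $\partial=\partial/\partial t$ and $\nabla_i$ is the gradient in $\mathbf r_i\in\mathbb R^3$. $\rho\ge0$ and $S$ are real functions, twice continuously differentiable almost everywhere; the zero set of $\rho$ has measure zero for each time; $\Psi=\sqrt\rho\,e^{iS/\hbar}$, and $\rho=\Psi^*\Psi$ is normalized to one. All equalities are understood almost everywhere. Definitions: $\zeta_0=\hbar/2$, $\zeta=\zeta_0/m$, $\rho_m=m\rho$, $\eta=\zeta_0\rho$, $\theta=-\zeta_0\ln\rho$; $\mathbf v_i=\frac1m\nabla_iS$, $\mathbf u_i=\frac1m\nabla_i\theta=-\zeta\,\nabla_i\rho/\rho$; $P_i=\zeta_0\nabla_i\cdot(\rho\mathbf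 u_i)$, $p_i=-\zeta_0\nabla_i\cdot(\rho\mathbf v_i)$; $E=-\partial S$, $F=-\partial\theta$; $\hat H=-\frac{\hbar^2}{2m}\sum_{i=1}^n\nabla_i^2+U$ with $U$ a real-valued potential. *)

theory Defs
  imports "HOL-Analysis.Analysis"
begin

text \<open>
  A point is \<open>(t, r)\<close> with time \<open>t\<close> and particle positions \<open>r $ i \<in> \<real>\<^sup>3\<close>; the finite index
  type \<open>'n\<close> enumerates the \<open>n = CARD('n) \<ge> 1\<close> particles.
\<close>

type_synonym 'n point = "real \<times> ((real ^ 3) ^ 'n)"


subsection \<open>Partial derivatives\<close>

text \<open>
  All derivatives are total functions; where the derivative does not exist, the value is
  that of the (arbitrary) choice made by \<open>vector_derivative\<close>.
\<close>

definition dir_deriv ::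
    "'a::real_normed_vector \<Rightarrow> ('a \<Rightarrow> 'b::real_normed_vector) \<Rightarrow> 'a \<Rightarrow> 'b" where
  "dir_deriv e f x = vector_derivative (\<lambda>s. f (x + s *\<^sub>R e)) (at 0)"

definition time_deriv :: "('n::finite point \<Rightarrow> 'b::real_normed_vector) \<Rightarrow> 'n point \<Rightarrow> 'b" where
  "time_deriv f = dir_deriv (1, 0) f"

definition space_deriv ::
    "'n \<Rightarrow> 3 \<Rightarrow> ('n::finite point \<Rightarrow> 'b::real_normed_vector) \<Rightarrow> 'n point \<Rightarrow> 'b" where
  "space_deriv i k f = dir_deriv (0, axis i (axis k 1)) f"

definition grad ::
    "'n \<Rightarrow> ('n::finite point \<Rightarrow> 'b::real_normed_vector) \<Rightarrow> 'n point \<Rightarrow> 'b ^ 3" where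
  "grad i f x = (\<chi> k. space_deriv i k f x)"

definition divergence ::
    "'n \<Rightarrow> ('n::finite point \<Rightarrow> 'b::real_normed_vector ^ 3) \<Rightarrow> 'n point \<Rightarrow> 'b" where
  "divergence i f x = (\<Sum>k\<in>UNIV. space_deriv i k (\<lambda>y. f y $ k) x)"

definition laplacian ::
    "'n \<Rightarrow> ('n::finite point \<Rightarrow> 'b::real_normed_vector) \<Rightarrow> 'n point \<Rightarrow> 'b" where
  "laplacian i f = divergence i (grad i f)"


subsection \<open>Twice continuously differentiable functions\<close>

definition C2_on :: "('a::real_normed_vector \<Rightarrow> 'b::real_normed_vector) \<Rightarrow> 'a set \<Rightarrow> bool" where
  "C2_on f X \<longleftrightarrow>
     (\<exists>(f' :: 'a \<Rightarrow> 'a \<Rightarrow>\<^sub>L 'b) (f'' :: 'a \<Rightarrow> 'a \<Rightarrow>\<^sub>L ('a \<Rightarrow>\<^sub>L 'b)).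
        (\<forall>x\<in>X. (f has_derivative blinfun_apply (f' x)) (at x)) \<and>
        (\<forall>x\<in>X. (f' has_derivative blinfun_apply (f'' x)) (at x)) \<and>
        continuous_on X f'')"

definition C2_at :: "('a::real_normed_vector \<Rightarrow> 'b::real_normed_vector) \<Rightarrow> 'a \<Rightarrow> bool" where
  "C2_at f x \<longleftrightarrow> (\<exists>X. open X \<and> x \<in> X \<and> C2_on f X)"


subsection \<open>Fields built from density and phase\<close>

definition zeta0 :: "real \<Rightarrow> real" where
  "zeta0 hbar = hbar / 2"

definition zeta :: "real \<Rightarrow> real \<Rightarrow> real" where
  "zeta hbar m = zeta0 hbar / m"

definition mass_density :: "real \<Rightarrow> ('n::finite point \<Rightarrow> real) \<Rightarrow> 'n point \<Rightarrow> real" where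
  "mass_density m rho x = m * rho x"

definition eta :: "real \<Rightarrow> ('n::finite point \<Rightarrow> real) \<Rightarrow> 'n point \<Rightarrow> real" where
  "eta hbar rho x = zeta0 hbar * rho x"

definition theta :: "real \<Rightarrow> ('n::finite point \<Rightarrow> real) \<Rightarrow> 'n point \<Rightarrow> real" where
  "theta hbar rho x = - zeta0 hbar * ln (rho x)"

definition v_field :: "real \<Rightarrow> ('n::finite point \<Rightarrow> real) \<Rightarrow> 'n \<Rightarrow> 'n point \<Rightarrow> real ^ 3" where
  "v_field m S i x = (1 / m) *\<^sub>R grad i S x"

definition u_field ::
    "real \<Rightarrow> real \<Rightarrow> ('n::finite point \<Rightarrow> real) \<Rightarrow> 'n \<Rightarrow> 'n point \<Rightarrow> real ^ 3" where
  "u_field hbar m rho i x = (1 / m) *\<^sub>R grad i (theta hbar rho) x"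

definition w_field ::
    "real \<Rightarrow> real \<Rightarrow> ('n::finite point \<Rightarrow> real) \<Rightarrow> ('n point \<Rightarrow> real) \<Rightarrow> 'n \<Rightarrow> 'n point
      \<Rightarrow> real ^ 3" where
  "w_field hbar m rho S i x = u_field hbar m rho i x + v_field m S i x"

definition P_field ::
    "real \<Rightarrow> real \<Rightarrow> ('n::finite point \<Rightarrow> real) \<Rightarrow> 'n \<Rightarrow> 'n point \<Rightarrow> real" where
  "P_field hbar m rho i x =
     zeta0 hbar * divergence i (\<lambda>y. rho y *\<^sub>R u_field hbar m rho i y) x"

definition p_field ::
    "real \<Rightarrow> real \<Rightarrow> ('n::finite point \<Rightarrow> real) \<Rightarrow> ('n point \<Rightarrow> real) \<Rightarrow> 'n \<Rightarrow> 'n point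
      \<Rightarrow> real" where
  "p_field hbar m rho S i x =
     - zeta0 hbar * divergence i (\<lambda>y. rho y *\<^sub>R v_field m S i y) x"

definition E_field :: "('n::finite point \<Rightarrow> real) \<Rightarrow> 'n point \<Rightarrow> real" where
  "E_field S x = - time_deriv S x"

definition F_field :: "real \<Rightarrow> ('n::finite point \<Rightarrow> real) \<Rightarrow> 'n point \<Rightarrow> real" where
  "F_field hbar rho x = - time_deriv (theta hbar rho) x"

definition Ebar_field ::
    "real \<Rightarrow> ('n::finite point \<Rightarrow> real) \<Rightarrow> ('n point \<Rightarrow> real) \<Rightarrow> 'n point \<Rightarrow> real" where
  "Ebar_field hbar rho S x = E_field S x + F_field hbar rho x"

definition Psi ::
    "real \<Rightarrow> ('n::finite point \<Rightarrow> real) \<Rightarrow> ('n point \<Rightarrow> real) \<Rightarrow> 'n point \<Rightarrow> complex" where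
  "Psi hbar rho S x = complex_of_real (sqrt (rho x)) * exp (\<i> * complex_of_real (S x / hbar))"

definition hamiltonian ::
    "real \<Rightarrow> real \<Rightarrow> ('n::finite point \<Rightarrow> real) \<Rightarrow> ('n point \<Rightarrow> complex) \<Rightarrow> 'n point
      \<Rightarrow> complex" where
  "hamiltonian hbar m U f x =
     - complex_of_real (hbar\<^sup>2 / (2 * m)) * (\<Sum>i\<in>UNIV. laplacian i f x)
     + complex_of_real (U x) * f x"

lemma cnj_Psi_mult_Psi:
  assumes "rho x \<ge> 0"
  shows "cnj (Psi hbar rho S x) * Psi hbar rho S x = complex_of_real (rho x)"
proof -
  have "cnj (Psi hbar rho S x) * Psi hbar rho S x = complex_of_real ((norm (Psi hbar rho S x))\<^sup>2)"
    by (metis complex_norm_square mult.commute)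
  also have "norm (Psi hbar rho S x) = sqrt (rho x)"
    using assms by (simp add: Psi_def norm_mult)
  finally show ?thesis
    using assms by simp
qed

lemma dir_deriv_eq:
  assumes "(f has_derivative f') (at x)"
  shows "dir_deriv e f x = f' e"
proof -
  have "((\<lambda>s. x + s *\<^sub>R e) has_derivative (\<lambda>s. s *\<^sub>R e)) (at 0)"
    by (auto intro!: derivative_eq_intros)
  moreover have "(f has_derivative f') (at (x + 0 *\<^sub>R e))"
    using assms by simp
  ultimately have "((\<lambda>s. f (x + s *\<^sub>R e)) has_derivative (\<lambda>s. f' (s *\<^sub>R e))) (at 0)"
    using has_derivative_compose[of "\<lambda>s. x + s *\<^sub>R e" "\<lambda>s. s *\<^sub>R e" 0 UNIV f f'] by simp
  moreover have "f' (s *\<^sub>R e) = s *\<^sub>R f' e" for s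
    using assms by (simp add: has_derivative_linear linear_cmul)
  ultimately show ?thesis
    by (simp add: dir_deriv_def has_vector_derivative_def vector_derivative_at)
qed

lemma u_field_eq:
  assumes "rho differentiable (at x)" and "rho x > 0"
  shows "u_field hbar m rho i x = (- zeta hbar m / rho x) *\<^sub>R grad i rho x"
proof -
  obtain D where D: "(rho has_derivative D) (at x)"
    using assms(1) by (auto simp: differentiable_def)
  have "(theta hbar rho has_derivative (\<lambda>h. - zeta0 hbar * (D h / rho x))) (at x)"
    unfolding theta_def using assms(2)
    by (auto intro!: derivative_eq_intros D simp: divide_simps)
  then show ?thesis
    by (simp add: u_field_def grad_def space_deriv_def dir_deriv_eq[OF D] dir_deriv_eq
        zeta_def vec_eq_iff)
qed

end

theory Submission
  imports Defs
begin

text \<open>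
  Almost everywhere \<open>rho > 0\<close> and \<open>rho\<close>, \<open>S\<close> are twice continuously differentiable, so it
  suffices to argue at such a point. There the cross term \<open>rho\<^sub>m u\<^sub>i \<bullet> v\<^sub>i\<close> of
  \<open>1/2 rho\<^sub>m |w\<^sub>i|\<^sup>2\<close> and \<open>- eta div v\<^sub>i\<close> add up to \<open>p\<^sub>i\<close>, so the two energy equations
  differ by the common equation \<open>F rho = \<Sum> p\<^sub>i\<close>. Dividing \<open>Psi\<close> out of its derivatives,
  the real part of the Schroedinger equation is the equation for \<open>E rho\<close> and its imaginary
  part is the equation for \<open>F rho\<close>.
\<close>

section \<open>Directional derivatives\<close>

text \<open>The derivative is unique, so \<open>dir_deriv\<close> itself serves as its name; the
  derivative rules then give results directly in terms of \<open>dir_deriv\<close>.\<close>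

lemma differentiable_has_dir_deriv:
  assumes "f differentiable (at x)"
  shows "(f has_derivative (\<lambda>e. dir_deriv e f x)) (at x)"
proof -
  obtain D where D: "(f has_derivative D) (at x)"
    using assms by (auto simp: differentiable_def)
  then have "(\<lambda>e. dir_deriv e f x) = D"
    by (auto simp: dir_deriv_eq)
  with D show ?thesis by simp
qed

text \<open>The line through \<open>x\<close> is continuous, so agreement near \<open>x\<close>
  pulls back to agreement near parameter 0. This allows differentiating identities that hold only
  near a regular point.\<close>

lemma dir_deriv_cong:
  assumes "\<forall>\<^sub>F y in nhds x. f y = g y"
  shows "dir_deriv e f x = dir_deriv e g x"
proof -
  have "((\<lambda>s. x + s *\<^sub>R e) \<longlongrightarrow> x + 0 *\<^sub>R e) (nhds 0)"
    by (intro tendsto_intros filterlim_ident)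
  then have "filterlim (\<lambda>s. x + s *\<^sub>R e) (nhds x) (nhds 0)"
    by simp
  then have "\<forall>\<^sub>F s in nhds 0. f (x + s *\<^sub>R e) = g (x + s *\<^sub>R e)"
    using assms by (auto dest: filterlim_iff[THEN iffD1])
  then show ?thesis
    unfolding dir_deriv_def
    by (intro vector_derivative_cong_eq) (auto dest: eventually_nhds_x_imp_x)
qed

lemma space_deriv_cong:
  assumes "\<forall>\<^sub>F y in nhds x. f y = g y"
  shows "space_deriv i k f x = space_deriv i k g x"
  unfolding space_deriv_def by (rule dir_deriv_cong[OF assms])

lemma space_deriv_cmult:
  fixes f :: "'n::finite point \<Rightarrow> real"
  assumes "f differentiable (at x)"
  shows "space_deriv i k (\<lambda>y. c * f y) x = c * space_deriv i k f x"
  unfolding space_deriv_def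
  by (rule dir_deriv_eq)
    (auto intro!: derivative_eq_intros differentiable_has_dir_deriv assms)

lemma space_deriv_mult:
  fixes f g :: "'n::finite point \<Rightarrow> real"
  assumes "f differentiable (at x)" and "g differentiable (at x)"
  shows "space_deriv i k (\<lambda>y. f y * g y) x
    = f x * space_deriv i k g x + g x * space_deriv i k f x"
  unfolding space_deriv_def
  by (rule dir_deriv_eq)
    (auto intro!: derivative_eq_intros differentiable_has_dir_deriv assms)

lemma laplacian_eq:
  "laplacian i f x = (\<Sum>k\<in>UNIV. space_deriv i k (space_deriv i k f) x)"
  by (simp add: laplacian_def divergence_def grad_def)


section \<open>Twice continuously differentiable functions\<close>

lemma C2_at_eventually_C2_at:
  assumes "C2_at f x"
  shows "\<forall>\<^sub>F y in nhds x. C2_at f y"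
  using assms unfolding C2_at_def eventually_nhds by blast

lemma C2_at_differentiable:
  assumes "C2_at f x"
  shows "f differentiable (at x)"
  using assms unfolding C2_at_def C2_on_def differentiable_def by blast

lemma C2_at_eventually_differentiable:
  assumes "C2_at f x"
  shows "\<forall>\<^sub>F y in nhds x. f differentiable (at y)"
  using C2_at_eventually_C2_at[OF assms] by eventually_elim (rule C2_at_differentiable)

text \<open>Near \<open>x\<close>, \<open>dir_deriv e f\<close> is the bounded linear evaluation at
  \<open>e\<close> applied to the differentiable map \<open>f'\<close>.\<close>

lemma C2_at_dir_deriv_differentiable:
  assumes "C2_at f x"
  shows "dir_deriv e f differentiable (at x)"
proof -
  from assms obtain X f' f'' where X: "open X" "x \<in> X"
    and f': "\<And>y. y \<in> X \<Longrightarrow> (f has_derivative blinfun_apply (f' y)) (at y)"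
    and f'': "(f' has_derivative blinfun_apply (f'' x)) (at x)"
    unfolding C2_at_def C2_on_def by blast
  have "((\<lambda>y. blinfun_apply (f' y) e) has_derivative (\<lambda>h. blinfun_apply (f'' x h) e)) (at x)"
    by (auto intro!: derivative_eq_intros f'')
  then have "(dir_deriv e f has_derivative (\<lambda>h. blinfun_apply (f'' x h) e)) (at x)"
    by (rule has_derivative_transform_within_open[OF _ X]) (simp add: dir_deriv_eq[OF f'])
  then show ?thesis by (auto simp: differentiable_def)
qed

lemma C2_at_space_deriv_differentiable:
  assumes "C2_at f x"
  shows "space_deriv i k f differentiable (at x)"
  unfolding space_deriv_def by (rule C2_at_dir_deriv_differentiable[OF assms])

lemma C2_at_eventually_pos:
  fixes f :: "'a::real_normed_vector \<Rightarrow> real"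
  assumes "C2_at f x" and "f x > 0"
  shows "\<forall>\<^sub>F y in nhds x. f y > 0"
proof -
  have "(f \<longlongrightarrow> f x) (nhds x)"
    using C2_at_differentiable[OF assms(1)] differentiable_imp_continuous_within
    by (auto simp: continuous_within intro: tendsto_at_iff_tendsto_nhds[THEN iffD1])
  then show ?thesis
    using assms(2) by (rule order_tendstoD)
qed


section \<open>Positivity of the density\<close>

text \<open>The zero set need not be Borel, but its part inside the open set where \<open>f\<close> is
  continuous is, so that Fubini applies to it.\<close>

lemma AE_nonzero_of_slices:
  fixes f :: "'a::euclidean_space \<times> 'b::euclidean_space \<Rightarrow> real"
  assumes C2: "AE x in lebesgue. C2_at f x"
    and slices: "\<And>t. {r. f (t, r) = 0} \<in> null_sets lebesgue"
  shows "AE x in lebesgue. f x \<noteq> 0"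
proof -
  define G where "G = {x. C2_at f x}"
  have "open G"
    unfolding G_def C2_at_def open_subopen[of "Collect _"] by blast
  have "continuous_on G f"
    by (auto simp: G_def intro!: continuous_at_imp_continuous_on
        differentiable_imp_continuous_within C2_at_differentiable)
  then have "open (G \<inter> f -` (- {0}))"
    using \<open>open G\<close> by (intro continuous_open_preimage) auto
  \<comment> \<open>The complement of the bad set is a closed set united with an open one, hence
    Borel.\<close>
  moreover have "{x. \<not> (x \<in> G \<and> f x = 0)} = - G \<union> (G \<inter> f -` (- {0}))"
    by auto
  ultimately have meas: "{x. \<not> (x \<in> G \<and> f x = 0)} \<in> sets borel"
    using \<open>open G\<close> by (auto intro!: borel_closed)
  have "AE r in lborel. \<not> ((t, r) \<in> G \<and> f (t, r) = 0)" for t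
  proof -
    have "AE r in lebesgue. f (t, r) \<noteq> 0"
      using AE_not_in[OF slices[of t]] by simp
    then show ?thesis
      unfolding AE_completion_iff by eventually_elim simp
  qed
  \<comment> \<open>Fubini: a Borel set whose slices at fixed time are all null is null.\<close>
  then have "AE x in lborel \<Otimes>\<^sub>M lborel. \<not> (x \<in> G \<and> f x = 0)"
    using meas
    by (intro lborel_pair.AE_pair_measure) (simp_all only: lborel_prod sets_lborel space_lborel
        space_borel UNIV_I simp_thms eventually_True)
  then have "AE x in lebesgue. \<not> (x \<in> G \<and> f x = 0)"
    by (simp only: lborel_prod AE_completion_iff)
  with C2 show ?thesis
    by eventually_elim (simp add: G_def)
qed


section \<open>The fields at a regular point\<close>

lemma F_field_mult_rho:
  assumes "rho differentiable (at x)" and "rho x > 0"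
  shows "F_field hbar rho x * rho x = zeta0 hbar * time_deriv rho x"
proof -
  have "(theta hbar rho has_derivative (\<lambda>e. - zeta0 hbar * (dir_deriv e rho x / rho x))) (at x)"
    unfolding theta_def using assms
    by (auto intro!: derivative_eq_intros differentiable_has_dir_deriv simp: divide_simps)
  then show ?thesis
    using assms(2) by (simp add: F_field_def time_deriv_def dir_deriv_eq)
qed

text \<open>Since \<open>rho u_i = - zeta grad_i rho\<close> where \<open>rho\<close> is positive,
  the logarithm disappears before the divergence is taken.\<close>

lemma P_field_eq:
  assumes "C2_at rho x" and "rho x > 0"
  shows "P_field hbar m rho i x = - zeta0 hbar * zeta hbar m * laplacian i rho x"
proof -
  have "\<forall>\<^sub>F y in nhds x. (rho y *\<^sub>R u_field hbar m rho i y) $ k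
      = - zeta hbar m * space_deriv i k rho y" for k
    using C2_at_eventually_differentiable[OF assms(1)] C2_at_eventually_pos[OF assms]
    by eventually_elim (simp add: u_field_eq grad_def)
  from space_deriv_cong[OF this] have "space_deriv i k (\<lambda>y. (rho y *\<^sub>R u_field hbar m rho i y) $ k) x
      = - zeta hbar m * space_deriv i k (space_deriv i k rho) x" for k
    by (simp only: space_deriv_cmult C2_at_space_deriv_differentiable[OF assms(1)])
  then show ?thesis
    by (simp add: P_field_def divergence_def laplacian_eq sum_negf sum_distrib_left mult.assoc)
qed

lemma divergence_v_field:
  assumes "C2_at S x"
  shows "divergence i (v_field m S i) x = laplacian i S x / m"
  using space_deriv_cmult[OF C2_at_space_deriv_differentiable[OF assms], of _ _ "1 / m"]
  by (simp add: divergence_def v_field_def grad_def laplacian_eq sum_divide_distrib)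

text \<open>Leibniz rule. The two summands are kept apart: the first is to match the cross term of
  the squared norm of \<open>w_field\<close>, the second the term with \<open>eta\<close>.\<close>

lemma p_field_eq:
  assumes "C2_at rho x" and "C2_at S x"
  shows "p_field hbar m rho S i x
    = - zeta0 hbar * (grad i rho x \<bullet> v_field m S i x + rho x * divergence i (v_field m S i) x)"
proof -
  have "(\<lambda>y. v_field m S i y $ k) differentiable (at x)" for k
    using C2_at_space_deriv_differentiable[OF assms(2), of i k]
    by (simp add: v_field_def grad_def divide_inverse)
  then have "divergence i (\<lambda>y. rho y *\<^sub>R v_field m S i y) x
    = grad i rho x \<bullet> v_field m S i x + rho x * divergence i (v_field m S i) x"
    using C2_at_differentiable[OF assms(1)]
    by (simp add: divergence_def grad_def inner_vec_def space_deriv_mult sum.distrib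
        sum_distrib_left ac_simps)
  then show ?thesis by (simp add: p_field_def)
qed

text \<open>The cross term simplifies because \<open>m * zeta = zeta0\<close>, so that
  \<open>rho_m u_i = - zeta0 grad_i rho\<close>.\<close>

lemma norm_w_field:
  assumes "rho differentiable (at x)" and "rho x > 0" and "m > 0"
  shows "1 / 2 * mass_density m rho x * (norm (w_field hbar m rho S i x))\<^sup>2
    = 1 / 2 * mass_density m rho x * (norm (u_field hbar m rho i x))\<^sup>2
      + 1 / 2 * mass_density m rho x * (norm (v_field m S i x))\<^sup>2
      - zeta0 hbar * (grad i rho x \<bullet> v_field m S i x)"
proof -
  have "mass_density m rho x * (u_field hbar m rho i x \<bullet> v_field m S i x)
    = - zeta0 hbar * (grad i rho x \<bullet> v_field m S i x)"
    using assms by (simp add: u_field_eq mass_density_def zeta_def)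
  then show ?thesis
    by (simp add: w_field_def power2_norm_eq_inner inner_commute algebra_simps)
qed

lemma osmotic_energy_equation_iff:
  assumes "C2_at rho x" and "C2_at S x" and "rho x > 0" and "m > 0"
    and "F_field hbar rho x * rho x = (\<Sum>i\<in>UNIV. p_field hbar m rho S i x)"
  shows "Ebar_field hbar rho S x * rho x =
          (\<Sum>i\<in>UNIV. 1 / 2 * mass_density m rho x * (norm (w_field hbar m rho S i x))\<^sup>2
             + P_field hbar m rho i x
             - eta hbar rho x * divergence i (v_field m S i) x) + U x * rho x
     \<longleftrightarrow> E_field S x * rho x =
          (\<Sum>i\<in>UNIV. 1 / 2 * mass_density m rho x * (norm (u_field hbar m rho i x))\<^sup>2
             + 1 / 2 * mass_density m rho x * (norm (v_field m S i x))\<^sup>2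
             + P_field hbar m rho i x) + U x * rho x"
proof -
  \<comment> \<open>Per particle the two right-hand sides differ by exactly \<open>p_field\<close>;
    summed, this is \<open>F rho\<close>, the excess of \<open>Ebar rho\<close> over
    \<open>E rho\<close>.\<close>
  have "1 / 2 * mass_density m rho x * (norm (w_field hbar m rho S i x))\<^sup>2
             + P_field hbar m rho i x
             - eta hbar rho x * divergence i (v_field m S i) x
      = (1 / 2 * mass_density m rho x * (norm (u_field hbar m rho i x))\<^sup>2
             + 1 / 2 * mass_density m rho x * (norm (v_field m S i x))\<^sup>2
             + P_field hbar m rho i x) + p_field hbar m rho S i x" for i
    unfolding norm_w_field[OF C2_at_differentiable[OF assms(1)] assms(3,4)]
      p_field_eq[OF assms(1,2)]
    by (simp add: eta_def algebra_simps)
  then show ?thesis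
    using assms(5) by (simp only: sum.distrib Ebar_field_def distrib_right) linarith
qed


section \<open>The wave function\<close>

text \<open>This is the derivative of \<open>ln rho / 2 + i S / hbar\<close>, the logarithm of
  \<open>Psi\<close>, along \<open>e\<close>.\<close>

definition log_deriv_Psi where
  "log_deriv_Psi hbar rho S e x
     = Complex (dir_deriv e rho x / (2 * rho x)) (dir_deriv e S x / hbar)"

lemma Psi_has_derivative:
  assumes "rho differentiable (at x)" and "S differentiable (at x)" and "rho x > 0"
  shows "(Psi hbar rho S has_derivative
      (\<lambda>e. log_deriv_Psi hbar rho S e x * Psi hbar rho S x)) (at x)"
proof -
  \<comment> \<open>The derivatives of modulus and phase factor are each written as a multiple of
    the factor itself, so that in the product these multiples add up.\<close>
  have sq: "((\<lambda>y. sqrt (rho y)) has_derivative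
      (\<lambda>e. dir_deriv e rho x / (2 * rho x) * sqrt (rho x))) (at x)"
    using assms(3)
    by (auto intro!: derivative_eq_intros differentiable_has_dir_deriv[OF assms(1)]
        simp: field_simps simp flip: power2_eq_square)
  have "((\<lambda>y. \<i> * complex_of_real (S y / hbar)) has_derivative
      (\<lambda>e. \<i> * complex_of_real (dir_deriv e S x / hbar))) (at x)"
    by (intro has_derivative_mult_right has_derivative_of_real
        bounded_linear.has_derivative[OF bounded_linear_divide] differentiable_has_dir_deriv assms)
  from has_derivative_compose[OF this DERIV_exp[unfolded has_field_derivative_def]]
  have ex: "((\<lambda>y. exp (\<i> * complex_of_real (S y / hbar))) has_derivative
      (\<lambda>e. \<i> * complex_of_real (dir_deriv e S x / hbar) * exp (\<i> * complex_of_real (S x / hbar))))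
      (at x)"
    by (simp add: mult_ac)
  show ?thesis
    unfolding Psi_def
    by (rule derivative_eq_intros sq ex refl ext)+
      (simp add: log_deriv_Psi_def Complex_eq algebra_simps)
qed

lemma dir_deriv_Psi:
  assumes "rho differentiable (at x)" and "S differentiable (at x)" and "rho x > 0"
  shows "dir_deriv e (Psi hbar rho S) x = log_deriv_Psi hbar rho S e x * Psi hbar rho S x"
  using Psi_has_derivative[OF assms] by (rule dir_deriv_eq)

lemma log_deriv_Psi_has_derivative:
  assumes "C2_at rho x" and "C2_at S x" and "rho x > 0"
  shows "(log_deriv_Psi hbar rho S e has_derivative
      (\<lambda>h. Complex (dir_deriv h (dir_deriv e rho) x / (2 * rho x)
                - dir_deriv e rho x * dir_deriv h rho x / (2 * (rho x)\<^sup>2))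
             (dir_deriv h (dir_deriv e S) x / hbar))) (at x)"
proof -
  have re: "((\<lambda>y. dir_deriv e rho y / (2 * rho y)) has_derivative
      (\<lambda>h. dir_deriv h (dir_deriv e rho) x / (2 * rho x)
                - dir_deriv e rho x * dir_deriv h rho x / (2 * (rho x)\<^sup>2))) (at x)"
    using assms(3)
    by (auto intro!: derivative_eq_intros
        C2_at_dir_deriv_differentiable[OF assms(1), THEN differentiable_has_dir_deriv]
        C2_at_differentiable[OF assms(1), THEN differentiable_has_dir_deriv]
        simp: field_simps power2_eq_square)
  have im: "((\<lambda>y. dir_deriv e S y / hbar) has_derivative
      (\<lambda>h. dir_deriv h (dir_deriv e S) x / hbar)) (at x)"
    by (intro bounded_linear.has_derivative[OF bounded_linear_divide] differentiable_has_dir_deriv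
        C2_at_dir_deriv_differentiable assms)
  show ?thesis
    unfolding log_deriv_Psi_def Complex_eq
    by (intro has_derivative_add has_derivative_mult_right has_derivative_of_real re im)
qed

text \<open>With \<open>L\<close> the logarithmic derivative, the second derivative of
  \<open>Psi\<close> is \<open>(L' + L^2) Psi\<close>, and multiplying by \<open>cnj Psi\<close>
  turns \<open>Psi\<close> into \<open>rho\<close>. The coefficient 1/4 comes from -1/2 in
  \<open>L'\<close> plus 1/4 in \<open>L^2\<close>.\<close>

lemma cnj_Psi_second_dir_deriv:
  assumes "C2_at rho x" and "C2_at S x" and "rho x > 0"
  shows "cnj (Psi hbar rho S x) * dir_deriv e (dir_deriv e (Psi hbar rho S)) x
    = Complex (dir_deriv e (dir_deriv e rho) x / 2 - (dir_deriv e rho x)\<^sup>2 / (4 * rho x)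
               - rho x * (dir_deriv e S x)\<^sup>2 / hbar\<^sup>2)
        ((dir_deriv e rho x * dir_deriv e S x + rho x * dir_deriv e (dir_deriv e S) x) / hbar)"
    (is "_ = ?rhs")
proof -
  let ?L = "log_deriv_Psi hbar rho S e"
  \<comment> \<open>The formula is needed on a neighbourhood, since it is differentiated once
    more.\<close>
  have "\<forall>\<^sub>F y in nhds x. dir_deriv e (Psi hbar rho S) y = ?L y * Psi hbar rho S y"
    using C2_at_eventually_differentiable[OF assms(1)] C2_at_eventually_differentiable[OF assms(2)]
      C2_at_eventually_pos[OF assms(1,3)]
    by eventually_elim (rule dir_deriv_Psi)
  then have "dir_deriv e (dir_deriv e (Psi hbar rho S)) x
      = dir_deriv e (\<lambda>y. ?L y * Psi hbar rho S y) x"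
    by (rule dir_deriv_cong)
  also have "\<dots> = (dir_deriv e ?L x + (?L x)\<^sup>2) * Psi hbar rho S x"
    unfolding dir_deriv_eq[OF log_deriv_Psi_has_derivative[OF assms]]
    by (subst dir_deriv_eq[OF has_derivative_mult[OF log_deriv_Psi_has_derivative[OF assms]
        Psi_has_derivative[OF C2_at_differentiable[OF assms(1)]
          C2_at_differentiable[OF assms(2)] assms(3)]]])
      (simp add: algebra_simps power2_eq_square)
  finally have "cnj (Psi hbar rho S x) * dir_deriv e (dir_deriv e (Psi hbar rho S)) x
      = (dir_deriv e ?L x + (?L x)\<^sup>2) * complex_of_real (rho x)"
    using cnj_Psi_mult_Psi[of rho x hbar S] assms(3) by (simp add: mult_ac)
  also have "\<dots> = ?rhs"
    unfolding dir_deriv_eq[OF log_deriv_Psi_has_derivative[OF assms]] log_deriv_Psi_def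
    using assms(3)
    by (simp add: complex_eq_iff power2_eq_square field_simps add_divide_distrib)
  finally show ?thesis .
qed

section \<open>Real and imaginary parts of the Schroedinger equation\<close>

lemma cnj_Psi_time_deriv:
  assumes "rho differentiable (at x)" and "S differentiable (at x)" and "rho x > 0"
    and "hbar > 0"
  shows "\<i> * complex_of_real hbar * cnj (Psi hbar rho S x) * time_deriv (Psi hbar rho S) x
    = Complex (E_field S x * rho x) (F_field hbar rho x * rho x)"
proof -
  have "\<i> * complex_of_real hbar * cnj (Psi hbar rho S x) * time_deriv (Psi hbar rho S) x
    = \<i> * complex_of_real hbar * log_deriv_Psi hbar rho S (1, 0) x * complex_of_real (rho x)"
    using cnj_Psi_mult_Psi[of rho x hbar S] assms(3)
    by (simp add: time_deriv_def dir_deriv_Psi[OF assms(1-3)] mult_ac)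
  \<comment> \<open>The factor \<open>i\<close> swaps the parts: the phase gives the real part, and
    \<open>hbar / 2 = zeta0\<close> turns the density term into \<open>F rho\<close>.\<close>
  also have "\<dots> = Complex (E_field S x * rho x) (F_field hbar rho x * rho x)"
    using assms(3,4) unfolding F_field_mult_rho[OF assms(1,3)]
    by (simp add: log_deriv_Psi_def E_field_def complex_eq_iff time_deriv_def zeta0_def)
  finally show ?thesis .
qed

text \<open>In the real part the squared gradients of \<open>rho\<close> and \<open>S\<close> give
  the \<open>u\<close> and \<open>v\<close> energies and the second derivatives of
  \<open>rho\<close> give \<open>P_field\<close>; the imaginary part is the divergence of
  \<open>rho grad S\<close> up to a factor.\<close>

lemma cnj_Psi_laplacian:
  assumes "C2_at rho x" and "C2_at S x" and "rho x > 0" and "hbar > 0" and "m > 0"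
  shows "- complex_of_real (hbar\<^sup>2 / (2 * m))
        * (cnj (Psi hbar rho S x) * laplacian i (Psi hbar rho S) x)
    = Complex (1 / 2 * mass_density m rho x * (norm (u_field hbar m rho i x))\<^sup>2
             + 1 / 2 * mass_density m rho x * (norm (v_field m S i x))\<^sup>2
             + P_field hbar m rho i x) (p_field hbar m rho S i x)"
proof -
  have sq: "(norm v)\<^sup>2 = (\<Sum>k\<in>UNIV. (v $ k)\<^sup>2)" for v :: "real ^ 3"
    by (simp add: power2_norm_eq_inner inner_vec_def flip: power2_eq_square)
  \<comment> \<open>All four fields are brought to sums over coordinates with the common factor
    \<open>hbar^2 / (2 m)\<close>, so that they can be compared termwise.\<close>
  have u: "1 / 2 * mass_density m rho x * (norm (u_field hbar m rho i x))\<^sup>2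
    = (\<Sum>k\<in>UNIV. hbar\<^sup>2 / (2 * m) * ((space_deriv i k rho x)\<^sup>2 / (4 * rho x)))"
    unfolding sq sum_distrib_left u_field_eq[OF C2_at_differentiable[OF assms(1)] assms(3)]
    using assms(3-5)
    by (intro sum.cong) (simp_all add: mass_density_def zeta_def zeta0_def grad_def field_simps
        power2_eq_square)
  have v: "1 / 2 * mass_density m rho x * (norm (v_field m S i x))\<^sup>2
    = (\<Sum>k\<in>UNIV. hbar\<^sup>2 / (2 * m) * (rho x * (space_deriv i k S x)\<^sup>2 / hbar\<^sup>2))"
    unfolding sq sum_distrib_left v_field_def
    using assms(3-5)
    by (intro sum.cong) (simp_all add: mass_density_def grad_def field_simps power2_eq_square)
  have P: "P_field hbar m rho i x
    = - (\<Sum>k\<in>UNIV. hbar\<^sup>2 / (2 * m) * (space_deriv i k (space_deriv i k rho) x / 2))"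
    unfolding P_field_eq[OF assms(1,3)] laplacian_eq sum_distrib_left sum_negf[symmetric]
    by (intro sum.cong) (simp_all add: zeta_def zeta0_def field_simps power2_eq_square)
  have p: "p_field hbar m rho S i x
    = - (\<Sum>k\<in>UNIV. hbar\<^sup>2 / (2 * m) * ((space_deriv i k rho x * space_deriv i k S x
          + rho x * space_deriv i k (space_deriv i k S) x) / hbar))"
    unfolding p_field_eq[OF assms(1,2)] divergence_v_field[OF assms(2)] laplacian_eq inner_vec_def
      sum_distrib_left sum_divide_distrib sum.distrib[symmetric] sum_negf[symmetric]
    using assms(4,5)
    by (intro sum.cong)
      (simp_all add: zeta0_def v_field_def grad_def field_simps power2_eq_square)
  have \<Psi>: "cnj (Psi hbar rho S x) * laplacian i (Psi hbar rho S) x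
    = (\<Sum>k\<in>UNIV. Complex (space_deriv i k (space_deriv i k rho) x / 2
               - (space_deriv i k rho x)\<^sup>2 / (4 * rho x)
               - rho x * (space_deriv i k S x)\<^sup>2 / hbar\<^sup>2)
        ((space_deriv i k rho x * space_deriv i k S x
          + rho x * space_deriv i k (space_deriv i k S) x) / hbar))"
    by (simp only: laplacian_eq sum_distrib_left space_deriv_def
        cnj_Psi_second_dir_deriv[OF assms(1-3)])
  show ?thesis
    unfolding \<Psi> u v P p sum_distrib_left[symmetric]
    by (simp add: complex_eq_iff sum.distrib sum_subtractf algebra_simps
        add_divide_distrib diff_divide_distrib)
qed

lemma cnj_Psi_hamiltonian:
  assumes "C2_at rho x" and "C2_at S x" and "rho x > 0" and "hbar > 0" and "m > 0"
  shows "cnj (Psi hbar rho S x) * hamiltonian hbar m U (Psi hbar rho S) x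
    = Complex
       ((\<Sum>i\<in>UNIV. 1 / 2 * mass_density m rho x * (norm (u_field hbar m rho i x))\<^sup>2
             + 1 / 2 * mass_density m rho x * (norm (v_field m S i x))\<^sup>2
             + P_field hbar m rho i x) + U x * rho x)
       (\<Sum>i\<in>UNIV. p_field hbar m rho S i x)"
proof -
  \<comment> \<open>The potential is real, so its term \<open>U rho\<close> enters the real part
    only.\<close>
  have "cnj (Psi hbar rho S x) * hamiltonian hbar m U (Psi hbar rho S) x
    = (\<Sum>i\<in>UNIV. - complex_of_real (hbar\<^sup>2 / (2 * m))
          * (cnj (Psi hbar rho S x) * laplacian i (Psi hbar rho S) x))
      + complex_of_real (U x) * (cnj (Psi hbar rho S x) * Psi hbar rho S x)"
    unfolding sum_distrib_left[symmetric] by (simp add: hamiltonian_def algebra_simps)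
  also have "cnj (Psi hbar rho S x) * Psi hbar rho S x = complex_of_real (rho x)"
    using assms(3) by (simp add: cnj_Psi_mult_Psi)
  finally show ?thesis
    unfolding cnj_Psi_laplacian[OF assms] by (simp add: complex_eq_iff)
qed

section \<open>The equivalences almost everywhere\<close>

theorem theorem4:
  fixes hbar m :: real
    and rho S U :: "'n::finite point \<Rightarrow> real"
  assumes "hbar > 0" and "m > 0"
    and "\<And>x. rho x \<ge> 0"
    and "AE x in lebesgue. C2_at rho x"
    and "AE x in lebesgue. C2_at S x"
    and "\<And>t. {r. rho (t, r) = 0} \<in> null_sets lebesgue"
    and "\<And>t. has_bochner_integral lebesgue (\<lambda>r. rho (t, r)) 1"
  shows
    "((AE x in lebesgue. Ebar_field hbar rho S x * rho x =
          (\<Sum>i\<in>UNIV. 1 / 2 * mass_density m rho x * (norm (w_field hbar m rho S i x))\<^sup>2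
             + P_field hbar m rho i x
             - eta hbar rho x * divergence i (v_field m S i) x) + U x * rho x) \<and>
      (AE x in lebesgue. F_field hbar rho x * rho x = (\<Sum>i\<in>UNIV. p_field hbar m rho S i x))
      \<longleftrightarrow>
      (AE x in lebesgue. E_field S x * rho x =
          (\<Sum>i\<in>UNIV. 1 / 2 * mass_density m rho x * (norm (u_field hbar m rho i x))\<^sup>2
             + 1 / 2 * mass_density m rho x * (norm (v_field m S i x))\<^sup>2
             + P_field hbar m rho i x) + U x * rho x) \<and>
      (AE x in lebesgue. F_field hbar rho x * rho x = (\<Sum>i\<in>UNIV. p_field hbar m rho S i x)))
     \<and>
     ((AE x in lebesgue. Ebar_field hbar rho S x * rho x =
          (\<Sum>i\<in>UNIV. 1 / 2 * mass_density m rho x * (norm (w_field hbar m rho S i x))\<^sup>2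
             + P_field hbar m rho i x
             - eta hbar rho x * divergence i (v_field m S i) x) + U x * rho x) \<and>
      (AE x in lebesgue. F_field hbar rho x * rho x = (\<Sum>i\<in>UNIV. p_field hbar m rho S i x))
      \<longleftrightarrow>
      (AE x in lebesgue. \<i> * complex_of_real hbar * cnj (Psi hbar rho S x)
            * time_deriv (Psi hbar rho S) x =
          cnj (Psi hbar rho S x) * hamiltonian hbar m U (Psi hbar rho S) x))"
    (is "(((AE x in lebesgue. ?A x) \<and> (AE x in lebesgue. ?C x) \<longleftrightarrow>
           (AE x in lebesgue. ?B x) \<and> _)) \<and> (_ \<longleftrightarrow> (AE x in lebesgue. ?D x))")
proof -
  have "AE x in lebesgue. rho x \<noteq> 0"
    using assms(4,6) by (rule AE_nonzero_of_slices)
  with assms(4,5) have "AE x in lebesgue. C2_at rho x \<and> C2_at S x \<and> rho x > 0"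
    by eventually_elim (use assms(3) in \<open>auto simp: less_le\<close>)
  \<comment> \<open>Equivalence is claimed pointwise for conjunctions, because \<open>?A\<close> and
    \<open>?B\<close> agree only where \<open>?C\<close> holds.\<close>
  then have "AE x in lebesgue. (?A x \<and> ?C x \<longleftrightarrow> ?B x \<and> ?C x) \<and> (?B x \<and> ?C x \<longleftrightarrow> ?D x)"
  proof eventually_elim
    case (elim x)
    then have reg: "C2_at rho x" "C2_at S x" "rho x > 0" by auto
    have "?A x \<and> ?C x \<longleftrightarrow> ?B x \<and> ?C x"
      using osmotic_energy_equation_iff[OF reg \<open>m > 0\<close>] by blast
    moreover have "?B x \<and> ?C x \<longleftrightarrow> ?D x"
      unfolding cnj_Psi_hamiltonian[OF reg assms(1,2)]
        cnj_Psi_time_deriv[OF C2_at_differentiable[OF reg(1)] C2_at_differentiable[OF reg(2)]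
          reg(3) assms(1)]
      by (simp only: complex.inject)
    ultimately show ?case ..
  qed
  then have AC: "AE x in lebesgue. (?A x \<and> ?C x) = (?B x \<and> ?C x)"
    and BC: "AE x in lebesgue. (?B x \<and> ?C x) = ?D x"
    unfolding AE_conj_iff by (fact conjunct1, fact conjunct2)
  show ?thesis
    \<comment> \<open>Each pair of almost-everywhere equations is merged into one conjunction, which
      is then replaced by its pointwise equivalent.\<close>
    unfolding AE_conj_iff[symmetric] eventually_subst[OF AC] eventually_subst[OF BC] by simp
qed

end
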